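(* Let $n\geq 2$, let $A\in M_n(\mathbb C)$ and let $\gamma\geq 1$. Put $\eta(\gamma)=\dfrac{2}{\gamma+\gamma^{-1}}$. Then $$\Omega_{\eta(\gamma)}(A)=\bigcup_{\substack{S\in M_n(\mathbb C)\ \text{invertible}\\ \kappa(S)\leq\gamma}} W(S^{-1}AS).$$
   Context: $M_n(\mathbb C)$ is the set of complex $n\times n$ matrices. Vector norms on $\mathbb C^n$ are Euclidean, matrix norms are the induced operator norms, and the inner product $\langle\cdot,\cdot\rangle$ is linear in the first variable. For $B\in M_n(\mathbb C)$, the numerical range is $W(B)=\{\langle Bx,x\rangle : x\in\mathbb C^n,\ \|x\|=1\}$. For $q\in\mathbb C$ with $0<|q|\leq 1$, the $q$-numerical range is $W_q(B)=\{\langle Bx,y\rangle : x,y\in\mathbb C^n,\ \|x\|=\|y\|=1,\ \langle x,y\rangle=q\}$, and the scaled $q$-numerical range is $\Omega_q(B)=\frac1q W_q(B)=\{w/q : w\in W_q(B)\}$. For an invertible matrix $S$, the condition number is $\kappa(S)=\|S\|\,\|S^{-1}\|$. *)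

theory Defs
  imports "HOL-Analysis.Analysis"
begin

text \<open>
  The library inner product on \<^typ>\<open>complex ^ 'n\<close> is the real one, so the Hermitian inner
  product (linear in the first argument) is defined here. The library norm on this type is already
  the Euclidean norm.
\<close>

definition cinner :: "complex ^ 'n \<Rightarrow> complex ^ 'n \<Rightarrow> complex"
  where "cinner x y = (\<Sum>i\<in>UNIV. x $ i * cnj (y $ i))"

lemma cinner_self: "cinner x x = complex_of_real ((norm x)\<^sup>2)"
  by (simp add: cinner_def norm_vec_def L2_set_def sum_nonneg complex_mult_cnj cmod_power2)

definition numerical_range :: "complex ^ 'n ^ 'n \<Rightarrow> complex set"
  where "numerical_range B = {cinner (B *v x) x | x. norm x = 1}"

definition q_numerical_range :: "complex \<Rightarrow> complex ^ 'n ^ 'n \<Rightarrow> complex set"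
  where "q_numerical_range q B =
    {cinner (B *v x) y | x y. norm x = 1 \<and> norm y = 1 \<and> cinner x y = q}"

text \<open>Meaningful for \<open>0 < \<bar>q\<bar> \<le> 1\<close> only.\<close>

definition scaled_q_numerical_range :: "complex \<Rightarrow> complex ^ 'n ^ 'n \<Rightarrow> complex set"
  where "scaled_q_numerical_range q B = {w / q | w. w \<in> q_numerical_range q B}"

definition op_norm :: "complex ^ 'n ^ 'n \<Rightarrow> real"
  where "op_norm B = onorm ((*v) B)"

text \<open>Meaningful for invertible \<open>S\<close> only, since \<^const>\<open>matrix_inv\<close> is unspecified otherwise.\<close>

definition condition_number :: "complex ^ 'n ^ 'n \<Rightarrow> real"
  where "condition_number S = op_norm S * op_norm (matrix_inv S)"

definition eta :: "real \<Rightarrow> real"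
  where "eta \<gamma> = 2 / (\<gamma> + inverse \<gamma>)"

end

theory Submission
  imports Defs "HOL-Computational_Algebra.Fundamental_Theorem_Algebra"
begin

text \<open>
  For a unit vector \<open>x\<close> put \<open>u = S x\<close> and \<open>v = S\<^sup>-\<^sup>* x\<close>. Then \<open>\<langle>S\<^sup>-\<^sup>1 A S x, x\<rangle> = \<langle>A u, v\<rangle>\<close> and
  \<open>\<langle>u, v\<rangle> = 1\<close>, while Wielandt's inequality gives \<open>\<bar>u\<bar> \<bar>v\<bar> \<le> 1 / \<eta>(\<gamma>)\<close>. Splitting \<open>v\<close> along \<open>u\<close>,
  the scaled \<open>q\<close>-numerical range is seen to consist of circles around \<open>\<langle>A x, x\<rangle>\<close> whose radius is
  proportional to \<open>\<bar>A x - \<langle>A x, x\<rangle> x\<bar>\<close>, and the inequality places \<open>\<langle>A u, v\<rangle>\<close> inside such a circle.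
  Conversely, unit vectors with \<open>\<langle>x, y\<rangle> = \<eta>(\<gamma>)\<close> determine an explicit Hermitian \<open>S\<close>, a perturbation of
  the identity on the span of \<open>x\<close> and \<open>y\<close>, with \<open>\<kappa>(S) \<le> \<gamma>\<close>.
\<close>

section \<open>Hermitian inner product, adjoint and operator norm\<close>

lemma cinner_add_left: "cinner (x + y) z = cinner x z + cinner y z"
  by (simp add: cinner_def distrib_right sum.distrib)

lemma cinner_add_right: "cinner x (y + z) = cinner x y + cinner x z"
  by (simp add: cinner_def distrib_left sum.distrib)

lemma cinner_diff_left: "cinner (x - y) z = cinner x z - cinner y z"
  by (simp add: cinner_def left_diff_distrib sum_subtractf)

lemma cinner_diff_right: "cinner x (y - z) = cinner x y - cinner x z"
  by (simp add: cinner_def right_diff_distrib sum_subtractf)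

lemma cinner_smult_left: "cinner (c *s x) y = c * cinner x y"
  by (simp add: cinner_def sum_distrib_left mult_ac)

lemma cinner_smult_right: "cinner x (c *s y) = cnj c * cinner x y"
  by (simp add: cinner_def sum_distrib_left mult_ac)

lemma cinner_commute: "cinner y x = cnj (cinner x y)"
  by (simp add: cinner_def mult_ac)

lemmas cinner_simps = cinner_add_left cinner_add_right cinner_diff_left cinner_diff_right
  cinner_smult_left cinner_smult_right

lemma Re_cinner: "Re (cinner x y) = x \<bullet> y"
  by (simp add: cinner_def inner_vec_def inner_complex_def)

lemma norm_eq_of_cinner:
  assumes "cinner x x = complex_of_real (r\<^sup>2)" and "0 \<le> r"
  shows "norm x = r"
proof -
  have "(norm x)\<^sup>2 = r\<^sup>2" using assms(1) unfolding cinner_self of_real_eq_iff .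
  then show ?thesis using assms(2) by (simp add: power2_eq_imp_eq)
qed

lemma norm_cinner_le: "cmod (cinner x y) \<le> norm x * norm y"
proof -
  have "cmod (cinner x y) \<le> (\<Sum>i\<in>UNIV. \<bar>cmod (x $ i)\<bar> * \<bar>cmod (y $ i)\<bar>)"
    unfolding cinner_def by (rule order_trans[OF norm_sum]) (simp add: norm_mult)
  also have "\<dots> \<le> norm x * norm y"
    unfolding norm_vec_def by (rule L2_set_mult_ineq)
  finally show ?thesis .
qed

lemma norm_vector_smult: "norm (c *s x) = cmod c * norm (x :: complex ^ 'n)"
  by (simp add: norm_vec_def norm_mult L2_set_right_distrib)

definition cadjoint :: "complex ^ 'n ^ 'n \<Rightarrow> complex ^ 'n ^ 'n"
  where "cadjoint B = (\<chi> i j. cnj (B $ j $ i))"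

lemma cinner_cadjoint: "cinner (B *v x) y = cinner x (cadjoint B *v y)"
proof -
  have "cinner (B *v x) y = (\<Sum>i\<in>UNIV. \<Sum>j\<in>UNIV. B $ i $ j * x $ j * cnj (y $ i))"
    by (simp add: cinner_def matrix_vector_mult_def sum_distrib_right)
  also have "\<dots> = (\<Sum>j\<in>UNIV. \<Sum>i\<in>UNIV. B $ i $ j * x $ j * cnj (y $ i))"
    by (rule sum.swap)
  also have "\<dots> = cinner x (cadjoint B *v y)"
    by (simp add: cinner_def cadjoint_def matrix_vector_mult_def sum_distrib_left mult_ac)
  finally show ?thesis .
qed

lemma inner_cadjoint: "(B *v x) \<bullet> y = x \<bullet> (cadjoint B *v y)"
  by (metis Re_cinner cinner_cadjoint)

lemma norm_matrix_mult_le: "norm (B *v x) \<le> op_norm B * norm x"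
  unfolding op_norm_def by (rule onorm) simp

text \<open>With \<open>z\<close> the image of \<open>y\<close> under the adjoint,
  \<open>norm z\<close> squared is the inner product of \<open>B z\<close> and \<open>y\<close>, so
  Cauchy-Schwarz leaves one factor \<open>norm z\<close> to cancel.\<close>

lemma cadjoint_bound: "norm (cadjoint B *v y) \<le> op_norm B * norm y"
proof (cases "cadjoint B *v y = 0")
  case True
  then show ?thesis
    using order_trans[OF norm_ge_zero norm_matrix_mult_le[of B y]] by simp
next
  case False
  let ?z = "cadjoint B *v y"
  have "norm ?z * norm ?z = (B *v ?z) \<bullet> y"
    by (simp add: inner_cadjoint power2_norm_eq_inner flip: power2_eq_square)
  also have "\<dots> \<le> norm (B *v ?z) * norm y"
    by (rule norm_cauchy_schwarz)
  also have "\<dots> \<le> (op_norm B * norm ?z) * norm y"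
    by (intro mult_right_mono norm_matrix_mult_le) simp
  finally have "norm ?z * norm ?z \<le> norm ?z * (op_norm B * norm y)"
    by (simp add: mult_ac)
  with False show ?thesis by simp
qed

section \<open>Existence of an eigenvector\<close>

text \<open>Split off a root: \<open>p = (X - z) q\<close>. Either \<open>q(A) w\<close> is nonzero,
  and then an eigenvector for \<open>z\<close>, or \<open>q\<close> annihilates \<open>w\<close> and
  has smaller degree.\<close>

lemma eigenvector_of_annihilator:
  fixes A :: "complex ^ 'n ^ 'n"
  assumes "p \<noteq> 0" "degree p \<le> N" "w \<noteq> 0"
    and "(\<Sum>i\<le>N. coeff p i *s (((*v) A) ^^ i) w) = 0"
  shows "\<exists>v l. v \<noteq> 0 \<and> A *v v = l *s v"
  using assms
proof (induction N arbitrary: p)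
  case 0
  then have "coeff p 0 = 0" by simp
  with 0 show ?case by (metis bot_nat_0.extremum_uniqueI leading_coeff_0_iff)
next
  case (Suc N)
  let ?f = "\<lambda>i. (((*v) A) ^^ i) w"
  show ?case
  proof (cases "degree p = 0")
    case True
    then have "(\<Sum>i\<le>Suc N. coeff p i *s ?f i) = coeff p 0 *s w"
      by (subst sum.atMost_Suc_shift) (simp add: coeff_eq_0)
    with Suc.prems True show ?thesis
      by (metis leading_coeff_0_iff vector_mul_eq_0)
  next
    case False
    then obtain z where "poly p z = 0"
      using fundamental_theorem_of_algebra[of p] by (auto simp: constant_degree)
    then obtain q where q: "p = [:- z, 1:] * q"
      by (auto simp: poly_eq_0_iff_dvd)
    with Suc.prems have "q \<noteq> 0" by auto
    then have "degree p = Suc (degree q)"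
      unfolding q by (subst degree_mult_eq) auto
    with Suc.prems have dq: "degree q \<le> N" by simp
    define v where "v = (\<Sum>i\<le>N. coeff q i *s ?f i)"
    have Av: "A *v v = (\<Sum>i\<le>N. coeff q i *s ?f (Suc i))"
      by (simp add: v_def vec.linear_sum[OF matrix_vector_mul_linear_gen] vec.scale
          matrix_vector_mult_scaleR vector_scalar_commute)
    have zv: "z *s v = (\<Sum>i\<le>Suc N. (z * coeff q i) *s ?f i)"
      using dq by (simp add: v_def coeff_eq_0 vec.scale_sum_right)
    have "(\<Sum>i\<le>Suc N. coeff p i *s ?f i)
        = (\<Sum>i\<le>Suc N. coeff (pCons 0 q) i *s ?f i) - (\<Sum>i\<le>Suc N. (z * coeff q i) *s ?f i)"
      unfolding sum_subtractf[symmetric] by (rule sum.cong) (auto simp: q vec.scale_left_diff_distrib)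
    \<comment> \<open>Multiplying \<open>q\<close> by \<open>X\<close> shifts its coefficients by
      one, which matches the shifted powers in \<open>A *v v\<close>.\<close>
    also have "\<dots> = A *v v - z *s v"
      unfolding Av zv by (subst sum.atMost_Suc_shift) simp
    finally have "A *v v = z *s v" using Suc.prems by simp
    then show ?thesis
      using Suc.IH[OF \<open>q \<noteq> 0\<close> dq \<open>w \<noteq> 0\<close>] v_def by blast
  qed
qed

lemma exists_eigenvector:
  fixes A :: "complex ^ 'n ^ 'n"
  shows "\<exists>v l. v \<noteq> 0 \<and> A *v v = l *s v"
proof -
  \<comment> \<open>Any nonzero start vector serves: \<open>w, A w, ..., A^n w\<close> are
    \<open>n + 1\<close> vectors in dimension \<open>n\<close>, so a nonzero polynomial in
    \<open>A\<close> annihilates \<open>w\<close>.\<close>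
  define w :: "complex ^ 'n" where "w = axis undefined 1"
  have w: "w \<noteq> 0" by (simp add: w_def axis_eq_0_iff)
  define n where "n = CARD('n)"
  let ?f = "\<lambda>i. (((*v) A) ^^ i) w"
  have "\<exists>c. (\<exists>i\<le>n. c i \<noteq> 0) \<and> (\<Sum>i\<le>n. c i *s ?f i) = 0"
  proof (cases "inj_on ?f {..n}")
    case True
    then have "card (?f ` {..n}) = Suc n" by (simp add: card_image)
    then have "vec.dependent (?f ` {..n})"
      using vec.independent_card_le_dim[OF subset_UNIV, of "?f ` {..n}"]
      by (auto simp: n_def vec_dim_card simp del: vec.dim_UNIV)
    then obtain u where "\<exists>v\<in>?f ` {..n}. u v \<noteq> 0" "(\<Sum>v\<in>?f ` {..n}. u v *s v) = 0"
      by (subst (asm) vec.dependent_finite) auto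
    then show ?thesis
      by (intro exI[of _ "u \<circ> ?f"]) (auto simp: sum.reindex[OF True])
  next
    case False
    then obtain i j where ij: "i \<le> n" "j \<le> n" "i \<noteq> j" "?f i = ?f j"
      by (auto simp: inj_on_def)
    \<comment> \<open>Dependence of the set of iterates does not register repetitions, so two equal
      iterates get the relation with weights 1 and -1.\<close>
    let ?c = "\<lambda>k. (if k = i then 1 else 0) - (if k = j then 1 else (0 :: complex))"
    have "?c k *s ?f k = (if k = i then ?f k else 0) - (if k = j then ?f k else 0)" for k
      by simp
    then have sum: "(\<Sum>k\<le>n. ?c k *s ?f k) = 0"
      using ij by (simp only: sum_subtractf) simp
    have "?c i \<noteq> 0" using ij by simp
    with ij(1) have "\<exists>k\<le>n. ?c k \<noteq> 0" by (intro exI[of _ i] conjI)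
    then show ?thesis by (intro exI[of _ ?c] conjI sum)
  qed
  then obtain c where c: "\<exists>i\<le>n. c i \<noteq> 0" "(\<Sum>i\<le>n. c i *s ?f i) = 0" by blast
  define p where "p = (\<Sum>i\<le>n. monom (c i) i)"
  have cp: "coeff p i = (if i \<le> n then c i else 0)" for i
    by (simp add: p_def coeff_sum)
  have "p \<noteq> 0"
    using c(1) cp by (metis coeff_0)
  moreover have "degree p \<le> n"
    by (rule degree_le) (simp add: cp)
  moreover have "(\<Sum>i\<le>n. coeff p i *s ?f i) = 0"
    using c(2) by (simp add: cp)
  ultimately show ?thesis using w by (intro eigenvector_of_annihilator)
qed

section \<open>Circles and disks in the scaled \<open>q\<close>-numerical range\<close>

lemma orthogonal_of_cinner: "cinner x y = 0 \<Longrightarrow> orthogonal x y"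
  by (metis Re_cinner orthogonal_def zero_complex.simps(1))

text \<open>Hermitian orthogonality to \<open>x\<close> is real orthogonality to both
  \<open>x\<close> and \<open>\<i> *s x\<close>, and the real dimension exceeds 2.\<close>

lemma exists_unit_cinner_orthogonal:
  fixes x :: "complex ^ 'n"
  assumes "CARD('n) \<ge> 2"
  shows "\<exists>z. norm z = 1 \<and> cinner z x = 0"
proof -
  have "dim {x, \<i> *s x} \<le> card {x, \<i> *s x}"
    by (rule dim_le_card') simp
  also have "\<dots> \<le> 2" by (simp add: card_insert_if)
  also have "2 < DIM(complex ^ 'n)" using assms by simp
  finally obtain z where z: "z \<noteq> 0" "\<And>y. y \<in> span {x, \<i> *s x} \<Longrightarrow> orthogonal z y"
    using orthogonal_to_subspace_exists[of "{x, \<i> *s x}"] by blast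
  have "Re (cinner z x) = 0" "Re (cinner z (\<i> *s x)) = 0"
    using z(2)[of x] z(2)[of "\<i> *s x"] by (auto simp: Re_cinner orthogonal_def span_base)
  then have "cinner z x = 0"
    by (simp add: cinner_smult_right complex_eq_iff)
  then show ?thesis
    using z(1) by (intro exI[of _ "complex_of_real (inverse (norm z)) *s z"])
      (simp add: cinner_smult_left norm_vector_smult norm_inverse)
qed

definition residual :: "complex ^ 'n ^ 'n \<Rightarrow> complex ^ 'n \<Rightarrow> complex ^ 'n"
  where "residual A x = A *v x - cinner (A *v x) x *s x"

lemma cinner_residual: "norm x = 1 \<Longrightarrow> cinner (residual A x) x = 0"
  by (simp add: residual_def cinner_simps cinner_self)

text \<open>A unit \<open>y\<close> with \<open>cinner x y = q\<close> is \<open>q x\<close> plus an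
  orthogonal part of length \<open>sqrt (1 - q^2) = q c\<close>. Taking that part along the residual
  and varying its phase traces the circle.\<close>

lemma scaled_q_numerical_range_circle:
  fixes A :: "complex ^ 'n ^ 'n"
  assumes n: "CARD('n) \<ge> 2" and q: "0 < q" "q \<le> 1" and x: "norm x = 1"
    and p: "cmod (p - cinner (A *v x) x) = sqrt (1 / q\<^sup>2 - 1) * norm (residual A x)"
  shows "p \<in> scaled_q_numerical_range (complex_of_real q) A"
proof -
  define c where "c = sqrt (1 / q\<^sup>2 - 1)"
  define r where "r = norm (residual A x)"
  define m where "m = cinner (A *v x) x"
  have c: "q\<^sup>2 + q\<^sup>2 * c\<^sup>2 = 1"
    using q by (simp add: c_def field_simps power_le_one)
  obtain z where z: "norm z = 1" "cinner z x = 0" "residual A x = complex_of_real r *s z"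
  proof (cases "r = 0")
    \<comment> \<open>A vanishing residual has no direction, so \<open>z\<close> is an arbitrary
      unit vector orthogonal to \<open>x\<close>.\<close>
    case True
    then show ?thesis using exists_unit_cinner_orthogonal[OF n, of x] that by (auto simp: r_def)
  next
    case False
    with x show ?thesis
      by (intro that[of "complex_of_real (inverse r) *s residual A x"])
        (auto simp: cinner_smult_left cinner_residual norm_vector_smult r_def norm_inverse)
  qed
  obtain w where w: "cmod w = 1" "p - m = of_real (c * r) * w"
  proof (cases "c * r = 0")
    case True
    then have "p - m = 0" using p by (simp only: c_def[symmetric] r_def[symmetric] m_def norm_eq_zero)
    then show ?thesis using True by (intro that[of 1]) simp_all
  next
    case False
    have "cmod (p - m) = c * r" using p by (simp only: c_def r_def m_def)
    moreover have "0 \<le> c * r"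
      by (metis calculation norm_ge_zero)
    then have "cmod (of_real (c * r)) = c * r"
      unfolding norm_of_real by (rule abs_of_nonneg)
    ultimately have "cmod ((p - m) / of_real (c * r)) = 1"
      unfolding norm_divide by (simp only: divide_self[OF False])
    moreover have "p - m = of_real (c * r) * ((p - m) / of_real (c * r))"
      using False by (simp del: of_real_mult)
    ultimately show ?thesis by (rule that)
  qed
  \<comment> \<open>The phase is conjugated because \<open>y\<close> enters the inner product in its
    antilinear slot.\<close>
  define y where "y = complex_of_real q *s x + (complex_of_real (q * c) * cnj w) *s z"
  have zx: "cinner x z = 0" using z(2) cinner_commute[of x z] by simp
  have unit: "cinner x x = 1" "cinner z z = 1" by (simp_all add: cinner_self x z)
  have ww: "w * cnj w = 1" using w(1) by (simp add: complex_norm_square[symmetric])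
  have "complex_of_real ((norm y)\<^sup>2) = of_real (q\<^sup>2) + of_real (q\<^sup>2 * c\<^sup>2) * (w * cnj w)"
    unfolding cinner_self[symmetric] y_def
    by (simp add: cinner_simps z zx unit power2_eq_square algebra_simps)
  also have "\<dots> = of_real 1" unfolding ww by (simp only: mult_1_right of_real_add[symmetric] c)
  finally have "cinner y y = of_real (1\<^sup>2)" unfolding cinner_self power_one .
  then have "norm y = 1" by (rule norm_eq_of_cinner) (rule zero_le_one)
  moreover have "cinner x y = of_real q"
    by (simp add: y_def cinner_simps zx cinner_self x)
  moreover have "cinner (A *v x) y = of_real q * p"
  proof -
    have "A *v x = m *s x + complex_of_real r *s z"
      using z(3) by (simp add: residual_def m_def algebra_simps)
    then have "cinner (A *v x) y = of_real q * (m + of_real (c * r) * w)"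
      by (simp add: y_def cinner_simps z zx cinner_self x algebra_simps)
    also have "m + of_real (c * r) * w = p" using w(2) by (simp add: algebra_simps)
    finally show ?thesis .
  qed
  ultimately have "of_real q * p \<in> q_numerical_range (of_real q) A"
    using x unfolding q_numerical_range_def by force
  then show ?thesis
    using q unfolding scaled_q_numerical_range_def by force
qed

text \<open>For \<open>n = 2\<close> a single \<open>x\<close> contributes only a circle. Its interior is reached by moving \<open>x\<close>
  along the connected unit sphere to an eigenvector, where the residual vanishes.\<close>

lemma scaled_q_numerical_range_disk:
  fixes A :: "complex ^ 'n ^ 'n"
  assumes n: "CARD('n) \<ge> 2" and q: "0 < q" "q \<le> 1" and x: "norm x = 1"
    and p: "cmod (p - cinner (A *v x) x) \<le> sqrt (1 / q\<^sup>2 - 1) * norm (residual A x)"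
  shows "p \<in> scaled_q_numerical_range (complex_of_real q) A"
proof -
  define f where
    "f y = cmod (p - cinner (A *v y) y) - sqrt (1 / q\<^sup>2 - 1) * norm (residual A y)" for y
  obtain v l where v: "v \<noteq> 0" "A *v v = l *s v" using exists_eigenvector by blast
  define e where "e = complex_of_real (inverse (norm v)) *s v"
  have e: "norm e = 1" "A *v e = l *s e"
    using v by (auto simp: e_def norm_vector_smult norm_inverse vec.scale mult.commute)
  have fe: "f e \<ge> 0"
    using e by (simp add: f_def residual_def cinner_smult_left cinner_self)
  have fx: "f x \<le> 0" using p by (simp add: f_def)
  have "continuous_on (sphere 0 1) (\<lambda>y. (A *v y) $ i)" for i
    by (intro continuous_intros matrix_vector_mult_linear_continuous_on)
  then have "continuous_on (sphere 0 1) f"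
    unfolding f_def residual_def cinner_def vector_scalar_mult_def
    by (intro continuous_intros matrix_vector_mult_linear_continuous_on)
  moreover have "connected (sphere (0 :: complex ^ 'n) 1)"
    using n by (intro connected_sphere) simp
  ultimately have "connected (f ` sphere 0 1)"
    by (rule connected_continuous_image)
  moreover have "f x \<in> f ` sphere 0 1" "f e \<in> f ` sphere 0 1" using x e by auto
  ultimately have "0 \<in> f ` sphere 0 1"
    using fx fe connectedD_interval by blast
  then obtain y where "norm y = 1" "f y = 0" by force
  then show ?thesis
    using scaled_q_numerical_range_circle[OF n q] by (simp add: f_def)
qed

section \<open>Wielandt's inequality\<close>

lemma cadjoint_mult: "cadjoint (A ** B) = cadjoint B ** cadjoint A"
  by (simp add: cadjoint_def matrix_matrix_mult_def vec_eq_iff mult.commute)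

lemma cadjoint_mat_1: "cadjoint (mat 1) = mat 1"
  by (simp add: cadjoint_def mat_def vec_eq_iff)

lemma op_norm_nonneg: "0 \<le> op_norm B"
  unfolding op_norm_def by (rule onorm_pos_le) simp

text \<open>Put \<open>P = S R\<close> with \<open>R\<close> the adjoint of \<open>S\<close>. Then
  \<open>u = P v\<close> and \<open>cinner u v = 1\<close>, so the claim compares
  \<open>norm (P v) * norm v\<close> with the quadratic form of \<open>P\<close> at
  \<open>v\<close>.\<close>

lemma wielandt_inequality:
  fixes S T :: "complex ^ 'n ^ 'n"
  assumes ST: "S ** T = mat 1" and TS: "T ** S = mat 1" and x: "norm x = 1"
  defines "k \<equiv> op_norm S * op_norm T"
  shows "1 \<le> k" and "norm (S *v x) * norm (cadjoint T *v x) \<le> (k + inverse k) / 2"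
proof -
  define a where "a = op_norm S"
  define t where "t = op_norm T"
  define R where "R = cadjoint S"
  define u where "u = S *v x"
  define v where "v = cadjoint T *v x"
  have Tu: "T *v u = x" by (simp add: u_def matrix_vector_mul_assoc TS)
  have Rv: "R *v v = x"
    by (simp add: R_def v_def matrix_vector_mul_assoc TS cadjoint_mat_1 flip: cadjoint_mult)
  have ua: "norm u \<le> a" using norm_matrix_mult_le[of S x] x by (simp add: u_def a_def)
  have vt: "norm v \<le> t" using cadjoint_bound[of T x] x by (simp add: v_def t_def)
  have at: "0 \<le> a" "0 \<le> t" by (simp_all add: a_def t_def op_norm_nonneg)
  have "1 \<le> t * norm u" using norm_matrix_mult_le[of T u] x by (simp add: Tu t_def)
  also have "\<dots> \<le> t * a" using ua at by (intro mult_left_mono)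
  finally show k1: "1 \<le> k" by (simp add: k_def a_def t_def mult.commute)
  then have pos: "0 < a" "0 < t"
    using at by (auto simp: k_def a_def[symmetric] t_def[symmetric] less_le)
  have kat: "k = a * t" by (simp add: k_def a_def t_def)
  show "norm (S *v x) * norm (cadjoint T *v x) \<le> (k + inverse k) / 2"
  proof (cases "k = 1")
    case True
    have "norm u * norm v \<le> a * t" using ua vt at by (intro mult_mono) auto
    with True show ?thesis by (simp add: kat u_def v_def)
  next
    case False
    \<comment> \<open>\<open>b\<close> bounds the singular values of \<open>S\<close> from below,
      and \<open>k = a / b\<close>. Excluding \<open>k = 1\<close> gives \<open>b < a\<close>, so
      the positive factor \<open>a^2 - b^2\<close> can be cancelled later.\<close>
    define b where "b = inverse t"
    have b: "0 < b" "k = a / b" using pos by (simp_all add: b_def kat field_simps)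
    have "b < a" using False k1 b by (simp add: field_simps)
    then have d: "b\<^sup>2 < a\<^sup>2" using b by (intro power_strict_mono) auto
    have R1: "(R *v z) \<bullet> (R *v z) \<le> a\<^sup>2 * (z \<bullet> z)" for z
      using power_mono[OF cadjoint_bound[of S z], of 2]
      by (simp add: R_def a_def power_mult_distrib power2_norm_eq_inner)
    have R2: "b\<^sup>2 * (z \<bullet> z) \<le> (R *v z) \<bullet> (R *v z)" for z
    proof -
      have "norm z * norm z = (S *v (T *v z)) \<bullet> z"
        by (simp add: matrix_vector_mul_assoc ST power2_norm_eq_inner flip: power2_eq_square)
      also have "\<dots> \<le> norm (T *v z) * norm (R *v z)"
        unfolding inner_cadjoint[of S] R_def by (rule norm_cauchy_schwarz)
      also have "\<dots> \<le> (t * norm z) * norm (R *v z)"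
        unfolding t_def by (intro mult_right_mono norm_matrix_mult_le) simp
      finally have "norm z \<le> t * norm (R *v z)"
        by (cases "z = 0") (simp_all add: mult_ac)
      then have "b * norm z \<le> norm (R *v z)"
        using pos by (simp add: b_def field_simps)
      then have "(b * norm z)\<^sup>2 \<le> (norm (R *v z))\<^sup>2"
        using b by (intro power_mono) auto
      then show ?thesis by (simp add: power_mult_distrib power2_norm_eq_inner)
    qed
    txt \<open>With \<open>M = a\<^sup>2 - S S\<^sup>*\<close> and \<open>N = S S\<^sup>* - b\<^sup>2\<close>, which are positive semidefinite, commute and
      add up to \<open>a\<^sup>2 - b\<^sup>2\<close>:
      \<open>(a\<^sup>2 - b\<^sup>2) \<langle>N v, M v\<rangle> = \<langle>M N v, N v\<rangle> + \<langle>N M v, M v\<rangle> \<ge> 0\<close>.\<close>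
    define m where "m = a\<^sup>2 *\<^sub>R v - u"
    define n where "n = u - b\<^sup>2 *\<^sub>R v"
    define w where "w = R *v u"
    have Rlin: "R *v m = a\<^sup>2 *\<^sub>R x - w" "R *v n = w - b\<^sup>2 *\<^sub>R x"
      by (simp_all add: m_def n_def w_def matrix_vector_mult_diff_distrib Rv
          linear_scale[OF bounded_linear.linear[OF matrix_vector_mul_bounded_linear]])
    have xx: "x \<bullet> x = 1" using x by (simp add: norm_eq_1)
    have xw: "x \<bullet> w = u \<bullet> u" by (simp add: w_def R_def u_def flip: inner_cadjoint)
    have uv: "u \<bullet> v = 1" by (simp add: u_def inner_cadjoint xx Rv[unfolded R_def])
    have "0 \<le> (a\<^sup>2 * (n \<bullet> n) - (R *v n) \<bullet> (R *v n)) + ((R *v m) \<bullet> (R *v m) - b\<^sup>2 * (m \<bullet> m))"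
      using R1[of n] R2[of m] by simp
    also have "\<dots> = (a\<^sup>2 - b\<^sup>2) * (a\<^sup>2 + b\<^sup>2 - u \<bullet> u - a\<^sup>2 * b\<^sup>2 * (v \<bullet> v))"
      unfolding Rlin
      by (simp add: m_def n_def inner_diff_left inner_diff_right inner_commute[of v u]
          inner_commute[of w x] xx xw uv algebra_simps power2_eq_square)
    finally have "(norm u)\<^sup>2 + (a * b * norm v)\<^sup>2 \<le> a\<^sup>2 + b\<^sup>2"
      using d by (simp add: zero_le_mult_iff power2_norm_eq_inner power_mult_distrib)
    moreover have "2 * norm u * (a * b * norm v) \<le> (norm u)\<^sup>2 + (a * b * norm v)\<^sup>2"
      by (rule sum_squares_bound)
    ultimately have "norm u * norm v \<le> (a\<^sup>2 + b\<^sup>2) / (2 * a * b)"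
      using pos b by (simp add: field_simps)
    also have "\<dots> = (k + inverse k) / 2"
      unfolding b(2) using pos b(1) by (simp add: field_simps power2_eq_square)
    finally show ?thesis by (simp add: u_def v_def)
  qed
qed

section \<open>Numerical ranges of similar matrices inside the scaled \<open>q\<close>-numerical
  range\<close>

lemma invertible_matrix_inv:
  assumes "invertible S"
  shows "S ** matrix_inv S = mat 1" "matrix_inv S ** S = mat 1"
  using someI_ex[OF assms[unfolded invertible_def]] by (simp_all add: matrix_inv_def)

lemma eta_bounds:
  assumes "\<gamma> \<ge> 1"
  shows "0 < eta \<gamma>" "eta \<gamma> \<le> 1"
proof -
  have "2 * \<gamma> \<le> \<gamma> * \<gamma> + 1"
    using zero_le_power2[of "\<gamma> - 1"] by (simp add: power2_eq_square algebra_simps)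
  then show "0 < eta \<gamma>" "eta \<gamma> \<le> 1"
    using assms by (simp_all add: eta_def field_simps add_pos_pos)
qed

lemma plus_inverse_mono:
  fixes k \<gamma> :: real
  assumes "1 \<le> k" "k \<le> \<gamma>"
  shows "k + inverse k \<le> \<gamma> + inverse \<gamma>"
proof -
  have "1 * 1 \<le> k * \<gamma>" using assms by (intro mult_mono) auto
  then have "0 \<le> (\<gamma> - k) * (1 - inverse (k * \<gamma>))"
    using assms by (intro mult_nonneg_nonneg) (simp_all add: inverse_le_1_iff del: inverse_mult_distrib)
  also have "\<dots> = (\<gamma> + inverse \<gamma>) - (k + inverse k)"
    using assms by (simp add: field_simps)
  finally show ?thesis by simp
qed

lemma numerical_range_similar_subset:
  fixes A S :: "complex ^ 'n ^ 'n"
  assumes n: "CARD('n) \<ge> 2" and g: "\<gamma> \<ge> 1"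
    and S: "invertible S" "condition_number S \<le> \<gamma>"
  shows "numerical_range (matrix_inv S ** A ** S)
    \<subseteq> scaled_q_numerical_range (complex_of_real (eta \<gamma>)) A"
proof
  fix p assume "p \<in> numerical_range (matrix_inv S ** A ** S)"
  then obtain x where x: "norm x = 1" and p0: "p = cinner ((matrix_inv S ** A ** S) *v x) x"
    by (auto simp: numerical_range_def)
  define T where "T = matrix_inv S"
  define u where "u = S *v x"
  define v where "v = cadjoint T *v x"
  note inv = invertible_matrix_inv[OF S(1), folded T_def]
  have p: "p = cinner (A *v u) v"
    by (simp add: p0 u_def v_def T_def matrix_vector_mul_assoc matrix_mul_assoc
        flip: cinner_cadjoint)
  have uv: "cinner u v = 1"
    by (simp add: u_def v_def matrix_vector_mul_assoc inv cinner_self x flip: cinner_cadjoint)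
  have "norm u * norm v \<le> (\<gamma> + inverse \<gamma>) / 2"
    using wielandt_inequality[OF inv x] plus_inverse_mono[of "op_norm S * op_norm T" \<gamma>] S(2)
    by (auto simp: u_def v_def T_def condition_number_def)
  then have uvn: "norm u * norm v \<le> 1 / eta \<gamma>" by (simp add: eta_def)
  have u0: "u \<noteq> 0" using uv by (auto simp: cinner_def)
  define x1 where "x1 = complex_of_real (inverse (norm u)) *s u"
  have x1: "norm x1 = 1" using u0 by (simp add: x1_def norm_vector_smult norm_inverse)
  have ux: "u = complex_of_real (norm u) *s x1" using u0 by (simp add: x1_def)
  \<comment> \<open>Since \<open>cinner u v = 1\<close>, the component of \<open>norm u *s v\<close>
    along \<open>x1\<close> is \<open>x1\<close> itself, and \<open>w\<close> is the orthogonal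
    remainder.\<close>
  define w where "w = complex_of_real (norm u) *s v - x1"
  have vx: "cinner x1 (complex_of_real (norm u) *s v) = 1"
    using uv u0 by (simp add: x1_def cinner_simps)
  then have wx: "cinner x1 w = 0" by (simp add: w_def cinner_simps cinner_self x1)
  have "(norm (x1 + w))\<^sup>2 = (norm x1)\<^sup>2 + (norm w)\<^sup>2"
    by (rule norm_add_Pythagorean[OF orthogonal_of_cinner[OF wx]])
  then have "(norm w)\<^sup>2 = (norm u * norm v)\<^sup>2 - 1"
    by (simp add: w_def norm_vector_smult x1)
  also have "\<dots> \<le> 1 / (eta \<gamma>)\<^sup>2 - 1"
    using power_mono[OF uvn, of 2] by (simp add: power_divide)
  finally have wn: "norm w \<le> sqrt (1 / (eta \<gamma>)\<^sup>2 - 1)" by (rule real_le_rsqrt)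
  have "p = cinner (A *v x1) (x1 + w)"
    unfolding p by (subst ux) (simp add: w_def cinner_simps vec.scale)
  \<comment> \<open>As \<open>w\<close> is orthogonal to \<open>x1\<close>, only the residual of
    \<open>A *v x1\<close> pairs with it.\<close>
  then have "p - cinner (A *v x1) x1 = cinner (residual A x1) w"
    by (simp add: residual_def cinner_simps wx)
  also have "cmod \<dots> \<le> norm (residual A x1) * norm w" by (rule norm_cinner_le)
  also have "\<dots> \<le> sqrt (1 / (eta \<gamma>)\<^sup>2 - 1) * norm (residual A x1)"
    using wn by (subst mult.commute) (rule mult_right_mono, simp_all)
  finally show "p \<in> scaled_q_numerical_range (complex_of_real (eta \<gamma>)) A"
    by (rule scaled_q_numerical_range_disk[OF n eta_bounds[OF g] x1])
qed

section \<open>Realising a point by an explicit similarity\<close>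

text \<open>For a unit vector \<open>e\<close> orthogonal to \<open>g\<close>, this Hermitian matrix
  sends \<open>e\<close> to \<open>g\<close> and \<open>g\<close> to \<open>norm g\<close> squared
  times \<open>e\<close>, and it kills the complement of their span.\<close>

definition swap_matrix :: "complex ^ 'n \<Rightarrow> complex ^ 'n \<Rightarrow> complex ^ 'n ^ 'n"
  where "swap_matrix e g = (\<chi> i j. e $ i * cnj (g $ j) + g $ i * cnj (e $ j))"

lemma swap_matrix_mult: "swap_matrix e g *v u = cinner u g *s e + cinner u e *s g"
  by (simp add: swap_matrix_def cinner_def matrix_vector_mult_def vec_eq_iff distrib_left
      sum.distrib sum_distrib_left mult_ac)

lemma cinner_swap_matrix: "cinner (swap_matrix e g *v u) v = cinner u (swap_matrix e g *v v)"
  using cinner_commute[of v g] cinner_commute[of v e]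
  by (simp add: swap_matrix_mult cinner_simps)

text \<open>Pythagoras applies to the image, along \<open>e\<close> and \<open>g\<close>, and to
  \<open>u\<close>, split along \<open>e\<close>; Cauchy-Schwarz bounds the pairing of the remainder
  with \<open>g\<close>.\<close>

lemma norm_swap_matrix_mult_le:
  assumes e: "norm e = 1" and eg: "cinner e g = 0"
  shows "norm (swap_matrix e g *v u) \<le> norm g * norm u"
proof -
  define c where "c = cinner u e"
  define w where "w = u - c *s e"
  have we: "cinner w e = 0" by (simp add: w_def c_def cinner_simps cinner_self e)
  then have ew: "cinner (c *s e) w = 0"
    using cinner_commute[of w e] by (simp add: cinner_simps)
  have "(norm (c *s e + w))\<^sup>2 = (norm (c *s e))\<^sup>2 + (norm w)\<^sup>2"
    by (rule norm_add_Pythagorean[OF orthogonal_of_cinner[OF ew]])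
  then have u2: "(norm u)\<^sup>2 = (cmod c)\<^sup>2 + (norm w)\<^sup>2"
    by (simp add: w_def norm_vector_smult e)
  have ug: "cinner u g = cinner w g" by (simp add: w_def cinner_simps eg)
  have "cinner (cinner u g *s e) (c *s g) = 0" by (simp add: cinner_simps eg)
  from norm_add_Pythagorean[OF orthogonal_of_cinner[OF this]]
  have "(norm (swap_matrix e g *v u))\<^sup>2 = (cmod (cinner w g))\<^sup>2 + (cmod c * norm g)\<^sup>2"
    by (simp add: swap_matrix_mult c_def[symmetric] ug norm_vector_smult e)
  also have "\<dots> \<le> (norm w * norm g)\<^sup>2 + (cmod c * norm g)\<^sup>2"
    by (intro add_right_mono power_mono norm_cinner_le) simp
  also have "\<dots> = (norm g * norm u)\<^sup>2"
    by (simp add: power_mult_distrib u2 algebra_simps)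
  finally show ?thesis by (rule power2_le_imp_le) simp
qed

lemma scaled_q_numerical_range_imp_similar:
  fixes A :: "complex ^ 'n ^ 'n"
  assumes g: "\<gamma> \<ge> 1" and p: "p \<in> scaled_q_numerical_range (complex_of_real (eta \<gamma>)) A"
  obtains S where "invertible S" "condition_number S \<le> \<gamma>"
    "p \<in> numerical_range (matrix_inv S ** A ** S)"
proof -
  define q where "q = eta \<gamma>"
  note q = eta_bounds[OF g, folded q_def]
  obtain x y where x: "norm x = 1" and y: "norm y = 1" and xy: "cinner x y = of_real q"
    and p: "p = cinner (A *v x) y / of_real q"
    using p by (auto simp: scaled_q_numerical_range_def q_numerical_range_def q_def)
  have yx: "cinner y x = of_real q" using cinner_commute[of y x] xy by simp
  \<comment> \<open>\<open>2 * c\<close> is the norm of \<open>x + y\<close>, so the factor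
    \<open>h\<close> below normalises \<open>x + y\<close> to \<open>e\<close>.\<close>
  define c where "c = sqrt ((1 + q) / 2)"
  have c: "c > 0" "c\<^sup>2 = (1 + q) / 2" using q by (simp_all add: c_def)
  \<comment> \<open>Chosen so that \<open>(1 + t) / (1 - t) = \<gamma>\<close>; by \<open>t2\<close>
    it is also the ratio of the norms of \<open>x - y\<close> and \<open>x + y\<close>, hence the
    norm of \<open>g'\<close>.\<close>
  define t where "t = (\<gamma> - 1) / (\<gamma> + 1)"
  have t: "0 \<le> t" "t < 1" using g by (simp_all add: t_def)
  have t2: "t\<^sup>2 = (1 - q) / (1 + q)"
  proof -
    have "q = 2 * \<gamma> / (\<gamma>\<^sup>2 + 1)"
      using g by (simp add: q_def eta_def field_simps power2_eq_square)
    moreover have "\<gamma>\<^sup>2 + 1 > 0" by (simp add: add_nonneg_pos)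
    ultimately have "1 - q = (\<gamma> - 1)\<^sup>2 / (\<gamma>\<^sup>2 + 1)" "1 + q = (\<gamma> + 1)\<^sup>2 / (\<gamma>\<^sup>2 + 1)"
      by (simp_all add: field_simps power2_eq_square)
    then show ?thesis
      using \<open>\<gamma>\<^sup>2 + 1 > 0\<close> by (simp add: t_def power_divide)
  qed
  have unit: "cinner x x = 1" "cinner y y = 1" by (simp_all add: cinner_self x y)
  define h where "h = complex_of_real (inverse (2 * c))"
  define e where "e = h *s (x + y)"
  define g' where "g' = h *s (x - y)"
  have h2: "h * h = of_real (1 / (2 * (1 + q)))"
  proof -
    have "(inverse (2 * c))\<^sup>2 = 1 / (2 * (1 + q))"
      by (simp add: power_inverse power_mult_distrib c(2)) (use c q in \<open>simp add: field_simps\<close>)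
    then show ?thesis unfolding h_def of_real_mult[symmetric] power2_eq_square by (rule arg_cong)
  qed
  have ch: "cnj h = h" by (simp add: h_def)
  have "cinner e e = (h * h) * of_real (2 * (1 + q))"
    by (simp add: e_def cinner_simps ch unit xy yx algebra_simps)
  then have ee: "cinner e e = 1" using q unfolding h2 of_real_mult[symmetric] by simp
  then have e: "norm e = 1" using norm_eq_of_cinner[of e 1] by simp
  have "cinner g' g' = (h * h) * of_real (2 * (1 - q))"
    by (simp add: g'_def cinner_simps ch unit xy yx algebra_simps)
  also have "\<dots> = of_real (t\<^sup>2)"
  proof -
    have "1 / (2 * (1 + q)) * (2 * (1 - q)) = t\<^sup>2" unfolding t2 using q by (simp add: field_simps)
    then show ?thesis unfolding h2 of_real_mult[symmetric] by (rule arg_cong)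
  qed
  finally have gg: "cinner g' g' = of_real (t\<^sup>2)" .
  then have gt: "norm g' = t" using t(1) by (rule norm_eq_of_cinner)
  have eg: "cinner e g' = 0" "cinner g' e = 0"
    by (simp_all add: e_def g'_def cinner_simps unit xy yx ch algebra_simps)
  txt \<open>In the orthonormal basis \<open>e, g' / t\<close> of the span of \<open>x\<close> and \<open>y\<close>, the matrix \<open>S\<close> has diagonal
    entries \<open>1\<close> and off-diagonal entries \<open>t\<close>, so its eigenvalues \<open>1 + t\<close> and \<open>1 - t\<close> have ratio
    \<open>\<gamma>\<close>. It maps \<open>e\<close> to a multiple of \<open>x\<close> and \<open>y\<close> to a multiple of \<open>e\<close>.\<close>
  define S where "S = mat 1 + swap_matrix e g'"
  have Sv: "S *v u = u + swap_matrix e g' *v u" for u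
    by (simp add: S_def matrix_vector_mult_add_rdistrib)
  have up: "norm (S *v u) \<le> (1 + t) * norm u" for u
    using norm_triangle_ineq[of u "swap_matrix e g' *v u"]
      norm_swap_matrix_mult_le[OF e eg(1), of u] by (simp add: Sv gt algebra_simps)
  have low: "(1 - t) * norm u \<le> norm (S *v u)" for u
    using norm_diff_ineq[of u "swap_matrix e g' *v u"]
      norm_swap_matrix_mult_le[OF e eg(1), of u] by (simp add: Sv gt algebra_simps)
  have "u = 0" if "S *v u = 0" for u
    using low[of u] that t by (simp add: mult_le_0_iff)
  then have inv: "invertible S"
    by (auto simp: invertible_left_inverse matrix_left_invertible_ker)
  define T where "T = matrix_inv S"
  note TS = invertible_matrix_inv[OF inv, folded T_def]
  have "op_norm S \<le> 1 + t"
    unfolding op_norm_def by (rule onorm_le) (rule up)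
  moreover have "op_norm T \<le> 1 / (1 - t)"
    unfolding op_norm_def
  proof (rule onorm_le)
    fix u
    have "(1 - t) * norm (T *v u) \<le> norm u"
      using low[of "T *v u"] by (simp add: matrix_vector_mul_assoc TS)
    then show "norm (T *v u) \<le> 1 / (1 - t) * norm u" using t by (simp add: field_simps)
  qed
  ultimately have "condition_number S \<le> (1 + t) * (1 / (1 - t))"
    unfolding condition_number_def T_def using t op_norm_nonneg by (intro mult_mono) auto
  also have "\<dots> = \<gamma>" using g by (simp add: t_def field_simps)
  finally have cond: "condition_number S \<le> \<gamma>" .
  have Se: "S *v e = e + g'"
    by (simp add: Sv swap_matrix_mult ee eg)
  have Sd: "S *v (e - g') = complex_of_real (1 - t\<^sup>2) *s e"
    by (simp add: Sv swap_matrix_mult cinner_simps ee gg eg vec_eq_iff algebra_simps)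
  have xe: "e + g' = (2 * h) *s x" "e - g' = (2 * h) *s y"
    by (simp_all add: e_def g'_def vec_eq_iff algebra_simps)
  have Ssym: "cinner (S *v u) v = cinner u (S *v v)" for u v
    by (simp add: Sv cinner_simps cinner_swap_matrix)
  \<comment> \<open>The scaled \<open>e\<close> on the right is \<open>S *v (e - g')\<close>; moving
    the Hermitian \<open>S\<close> to the left cancels \<open>T\<close>.\<close>
  have "cinner ((T ** A ** S) *v e) (complex_of_real (1 - t\<^sup>2) *s e)
      = cinner (S *v (T *v (A *v (S *v e)))) (e - g')"
    unfolding Ssym Sd by (simp add: matrix_vector_mul_assoc matrix_mul_assoc)
  also have "\<dots> = cinner (A *v (e + g')) (e - g')"
    unfolding Se by (simp add: matrix_vector_mul_assoc matrix_mul_assoc TS)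
  also have "\<dots> = 4 * (h * h) * cinner (A *v x) y"
    unfolding xe by (simp add: vec.scale cinner_simps ch)
  also have "\<dots> = of_real (2 / (1 + q)) * (of_real q * p)"
  proof -
    have "4 * (h * h) = of_real (4 * (1 / (2 * (1 + q))))"
      by (simp only: h2 of_real_mult of_real_numeral)
    also have "4 * (1 / (2 * (1 + q))) = 2 / (1 + q)" using q by (simp add: field_simps)
    finally show ?thesis using q by (simp only: p) simp
  qed
  also have "\<dots> = of_real (1 - t\<^sup>2) * p"
  proof -
    have "1 - t\<^sup>2 = 2 / (1 + q) * q" unfolding t2 using q by (simp add: field_simps)
    then show ?thesis by (simp only: of_real_mult mult.assoc)
  qed
  finally have "of_real (1 - t\<^sup>2) * cinner ((T ** A ** S) *v e) e = of_real (1 - t\<^sup>2) * p"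
    by (simp only: cinner_simps complex_cnj_complex_of_real)
  moreover have "t\<^sup>2 < 1" using t by (simp add: power_less_one_iff)
  ultimately have "p = cinner ((T ** A ** S) *v e) e"
    by (metis diff_gt_0_iff_gt less_irrefl mult_cancel_left of_real_eq_0_iff)
  then have "p \<in> numerical_range (matrix_inv S ** A ** S)"
    using e by (auto simp: numerical_range_def T_def)
  with inv cond show ?thesis by (rule that)
qed

theorem theorem2p2:
  fixes A :: "complex ^ 'n ^ 'n" and \<gamma> :: real
  assumes "CARD('n) \<ge> 2" and "\<gamma> \<ge> 1"
  shows "scaled_q_numerical_range (complex_of_real (eta \<gamma>)) A =
    (\<Union>S \<in> {S :: complex ^ 'n ^ 'n. invertible S \<and> condition_number S \<le> \<gamma>}.
      numerical_range (matrix_inv S ** A ** S))"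
proof
  show "scaled_q_numerical_range (complex_of_real (eta \<gamma>)) A \<subseteq>
    (\<Union>S \<in> {S :: complex ^ 'n ^ 'n. invertible S \<and> condition_number S \<le> \<gamma>}.
      numerical_range (matrix_inv S ** A ** S))" (is "?W \<subseteq> ?U")
  proof
    fix p assume "p \<in> scaled_q_numerical_range (complex_of_real (eta \<gamma>)) A"
    from scaled_q_numerical_range_imp_similar[OF assms(2) this] obtain S where
      "invertible S" "condition_number S \<le> \<gamma>" "p \<in> numerical_range (matrix_inv S ** A ** S)" .
    then show "p \<in> ?U" by (intro UN_I[of S] CollectI conjI)
  qed
  show "?U \<subseteq> ?W"
    by (rule UN_least, rule numerical_range_similar_subset[OF assms]) simp_all
qed

end
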